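(* For every bivariate copula $C$ we have $$\rho(C)\le 1-\frac{2}{3}\bigl(1-\phi(C)\bigr)^2.$$
   Context: Let $\mathbb I=[0,1]$. A bivariate copula is a function $C:\mathbb I^2\to\mathbb I$ with $C(0,v)=C(u,0)=0$, $C(u,1)=u$, $C(1,v)=v$ for all $u,v\in\mathbb I$, and $C(u_2,v_2)-C(u_2,v_1)-C(u_1,v_2)+C(u_1,v_1)\ge 0$ whenever $0\le u_1\le u_2\le 1$, $0\le v_1\le v_2\le 1$. Spearman's rho is $\rho(C)=12\int_{\mathbb I^2}C(u,v)\,du\,dv-3$ and Spearman's footrule is $\phi(C)=6\int_0^1C(u,u)\,du-2$. *)

theory Defs
  imports "HOL-Analysis.Analysis"
begin

text \<open>
  A copula is represented by a total function; only its values on the unit square are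
  constrained, and only those enter the two functionals below.
\<close>

definition copula :: "(real \<Rightarrow> real \<Rightarrow> real) \<Rightarrow> bool" where
  "copula C \<longleftrightarrow>
     (\<forall>u\<in>{0..1}. \<forall>v\<in>{0..1}. C u v \<in> {0..1}) \<and>
     (\<forall>v\<in>{0..1}. C 0 v = 0) \<and>
     (\<forall>u\<in>{0..1}. C u 0 = 0) \<and>
     (\<forall>u\<in>{0..1}. C u 1 = u) \<and>
     (\<forall>v\<in>{0..1}. C 1 v = v) \<and>
     (\<forall>u1 u2 v1 v2. 0 \<le> u1 \<and> u1 \<le> u2 \<and> u2 \<le> 1 \<and> 0 \<le> v1 \<and> v1 \<le> v2 \<and> v2 \<le> 1 \<longrightarrow>
        C u2 v2 - C u2 v1 - C u1 v2 + C u1 v1 \<ge> 0)"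

text \<open>
  Copulas are continuous on the unit square, so for them the Bochner integrals below
  are never the default value assigned to non-integrable functions.
\<close>

definition spearman_rho :: "(real \<Rightarrow> real \<Rightarrow> real) \<Rightarrow> real" where
  "spearman_rho C =
     12 * (LINT p:{0..1} \<times> {0..1}|(lborel :: (real \<times> real) measure). C (fst p) (snd p)) - 3"

definition spearman_footrule :: "(real \<Rightarrow> real \<Rightarrow> real) \<Rightarrow> real" where
  "spearman_footrule C = 6 * (LINT u:{0..1}|(lborel :: real measure). C u u) - 2"

end

theory Submission
  imports Defs
begin

text \<open>
  If \<open>(U, V)\<close> has joint distribution function \<open>C\<close>, then \<open>\<rho> = 1 - 6 E(U - V)\<^sup>2\<close> and
  \<open>\<phi> = 1 - 3 E\<bar>U - V\<bar>\<close>, so the claim is the Jensen inequality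
  \<open>(E\<bar>U - V\<bar>)\<^sup>2 \<le> E(U - V)\<^sup>2\<close>.  The proof below carries out this inequality on the level of
  distribution functions, without constructing the random variables.

  Put \<open>g u = u - C u u\<close> and \<open>c = 2 \<integral> g\<close>, so that \<open>c = E\<bar>U - V\<bar>\<close> and \<open>1 - \<phi> = 3 c\<close>.  It has to be
  shown that \<open>2 \<integral>\<integral> C \<le> 2 / 3 - c\<^sup>2\<close>.  The integral of \<open>C\<close> does not change when \<open>u\<close> and \<open>v\<close> are
  exchanged, so only \<open>C u v + C v u\<close> matters, and there are two upper bounds for it: the trivial
  \<open>2 min u v\<close>, and \<open>C u u + C v v = 2 min u v - (g u + g v - \<bar>u - v\<bar>)\<close>, which says that
  \<open>C\<close> gives nonnegative mass to the square with corners \<open>(u, u)\<close> and \<open>(v, v)\<close>.  The second bound is used on the strip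
  \<open>\<bar>u - v\<bar> \<le> c\<close>, the first one elsewhere (lemma \<open>copula_symmetrized_le\<close>).  As \<open>\<integral>\<integral> 2 min u v = 2 / 3\<close>,
  it remains to see that \<open>g u + g v - \<bar>u - v\<bar>\<close> has integral at least \<open>c\<^sup>2\<close> over the strip.

  This is lemma \<open>integral_strip_deficit\<close>.  Away from the two ends of the diagonal, a section of
  the strip has length \<open>2 c\<close> and \<open>\<bar>u - v\<bar>\<close> has integral \<open>c\<^sup>2\<close> over it, which suggests the value
  \<open>4 c \<integral> g - c\<^sup>2\<close>.  Near the ends the sections are shorter, but the bounds \<open>g u \<le> u\<close> and
  \<open>g u \<le> 1 - u\<close> limit what is lost there, and the smaller integral of \<open>\<bar>u - v\<bar>\<close> makes up for
  it exactly.  With \<open>\<integral> g = c / 2\<close> the value is \<open>2 c\<^sup>2 - c\<^sup>2 = c\<^sup>2\<close>; this choice of \<open>c\<close> is also the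
  one that maximises \<open>4 c \<integral> g - c\<^sup>2\<close>.
\<close>

section \<open>Integrals over squares\<close>

lemma set_integral_prod_iterated:
  fixes f :: "real \<times> real \<Rightarrow> real"
  assumes "set_integrable lborel (A \<times> B) f"
  shows "set_integrable lborel A (\<lambda>x. LINT y:B|lborel. f (x, y))"
    and "(LINT p:A \<times> B|lborel. f p) = (LINT x:A|lborel. LINT y:B|lborel. f (x, y))"
proof -
  let ?F = "\<lambda>p. indicator (A \<times> B) p *\<^sub>R f p"
  have F: "integrable (lborel \<Otimes>\<^sub>M lborel) ?F"
    using assms unfolding set_integrable_def by (simp add: lborel_prod)
  have eq: "(\<integral>y. ?F (x, y) \<partial>lborel) = indicator A x *\<^sub>R (LINT y:B|lborel. f (x, y))" for x
    by (auto simp: set_lebesgue_integral_def indicator_times split: split_indicator)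
  show "set_integrable lborel A (\<lambda>x. LINT y:B|lborel. f (x, y))"
    using lborel_pair.integrable_fst'[OF F] unfolding set_integrable_def eq .
  show "(LINT p:A \<times> B|lborel. f p) = (LINT x:A|lborel. LINT y:B|lborel. f (x, y))"
    using lborel_pair.integral_fst'[OF F]
    unfolding set_lebesgue_integral_def[of lborel "A \<times> B"] set_lebesgue_integral_def[of lborel A] eq
    by (simp add: lborel_prod)
qed

lemma set_integral_square_swap:
  fixes f :: "real \<times> real \<Rightarrow> real"
  assumes "set_integrable lborel (A \<times> A) f"
  shows "set_integrable lborel (A \<times> A) (\<lambda>p. f (snd p, fst p))"
    and "(LINT p:A \<times> A|lborel. f (snd p, fst p)) = (LINT p:A \<times> A|lborel. f p)"
proof -
  let ?F = "\<lambda>p. indicator (A \<times> A) p *\<^sub>R f p"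
  have F: "integrable (lborel \<Otimes>\<^sub>M lborel) ?F"
    using assms unfolding set_integrable_def by (simp add: lborel_prod)
  have eq: "(\<lambda>(x, y). ?F (y, x)) = (\<lambda>p. indicator (A \<times> A) p *\<^sub>R f (snd p, fst p))"
    by (auto simp: fun_eq_iff split: split_indicator)
  show "set_integrable lborel (A \<times> A) (\<lambda>p. f (snd p, fst p))"
    using lborel_pair.integrable_product_swap[OF F] unfolding set_integrable_def eq
    by (simp add: lborel_prod)
  show "(LINT p:A \<times> A|lborel. f (snd p, fst p)) = (LINT p:A \<times> A|lborel. f p)"
    using lborel_pair.integral_product_swap[OF borel_measurable_integrable[OF F]]
    unfolding set_lebesgue_integral_def eq by (simp add: lborel_prod)
qed

lemma set_integrable_unit_square_bounded:
  fixes f :: "real \<times> real \<Rightarrow> real"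
  assumes "f \<in> borel_measurable borel" "\<And>p. p \<in> {0..1} \<times> {0..1} \<Longrightarrow> \<bar>f p\<bar> \<le> B"
  shows "set_integrable lborel ({0..1} \<times> {0..1}) f"
proof -
  have "compact ({0..1} \<times> {0..1} :: (real \<times> real) set)"
    by (intro compact_Times compact_Icc)
  then show ?thesis
    unfolding set_integrable_def using assms
    by (intro integrableI_bounded_set_indicator[where B = B] emeasure_compact_finite)
       (auto intro: borel_closed compact_imp_closed)
qed

lemma set_integral_abs_diff:
  fixes u a b :: real
  assumes "0 \<le> a" "0 \<le> b"
  shows "(LINT v:{u - a..u + b}|lborel. \<bar>u - v\<bar>) = (a\<^sup>2 + b\<^sup>2) / 2"
proof -
  have "((\<lambda>v. \<bar>u - v\<bar>) has_integral (- (u - u)\<^sup>2 / 2 - (- (u - (u - a))\<^sup>2 / 2))) {u - a..u}"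
    using assms
    by (intro fundamental_theorem_of_calculus_interior)
       (auto intro!: continuous_intros derivative_eq_intros
          simp: has_real_derivative_iff_has_vector_derivative[symmetric] field_simps)
  moreover have "((\<lambda>v. \<bar>u - v\<bar>) has_integral ((u - (u + b))\<^sup>2 / 2 - (u - u)\<^sup>2 / 2)) {u..u + b}"
    using assms
    by (intro fundamental_theorem_of_calculus_interior)
       (auto intro!: continuous_intros derivative_eq_intros
          simp: has_real_derivative_iff_has_vector_derivative[symmetric] field_simps)
  ultimately have "((\<lambda>v. \<bar>u - v\<bar>) has_integral
      (- (u - u)\<^sup>2 / 2 - (- (u - (u - a))\<^sup>2 / 2) + ((u - (u + b))\<^sup>2 / 2 - (u - u)\<^sup>2 / 2))) {u - a..u + b}"
    using assms by (intro has_integral_combine) auto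
  moreover have "set_integrable lborel {u - a..u + b} (\<lambda>v. \<bar>u - v\<bar>)"
    by (intro borel_integrable_atLeastAtMost' continuous_intros)
  ultimately show ?thesis
    by (simp add: set_borel_integral_eq_integral integral_unique add_divide_distrib)
qed

lemma set_integral_const_minus_abs_diff:
  fixes u a b k :: real
  assumes "0 \<le> a" "0 \<le> b"
  shows "(LINT v:{u - a..u + b}|lborel. k - \<bar>u - v\<bar>) = k * (a + b) - (a\<^sup>2 + b\<^sup>2) / 2"
proof -
  have "set_integrable lborel {u - a..u + b} (\<lambda>v. \<bar>u - v\<bar>)"
    "set_integrable lborel {u - a..u + b} (\<lambda>v. k)"
    by (intro borel_integrable_atLeastAtMost' continuous_intros)+
  then show ?thesis
    using assms by (simp add: set_integral_diff set_integral_abs_diff set_integral_const)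
qed

lemma set_integral_real_FTC:
  fixes f F :: "real \<Rightarrow> real"
  assumes "a \<le> b" "\<And>x. (F has_real_derivative f x) (at x)" "continuous_on {a..b} f"
  shows "(LINT x:{a..b}|lborel. f x) = F b - F a"
  unfolding set_lebesgue_integral_def using assms
  by (intro integral_FTC_atLeastAtMost)
     (auto simp: has_real_derivative_iff_has_vector_derivative[symmetric]
           intro: has_field_derivative_at_within)

lemma set_integral_unit_id: "(LINT x:{0..1}|lborel. x) = (1 / 2 :: real)"
proof -
  have "(LINT x:{0..1}|lborel. x) = 1\<^sup>2 / 2 - (0::real)\<^sup>2 / 2"
    by (rule set_integral_real_FTC) (auto intro!: derivative_eq_intros continuous_intros)
  then show ?thesis by simp
qed

lemma set_integral_double_min:
  "(LINT p:{0..1} \<times> {0..1}|lborel. 2 * min (fst p) (snd p)) = (2 / 3 :: real)"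
proof -
  have inner: "(LINT v:{0..1}|lborel. 2 * min u v) = 2 * u - u\<^sup>2" if "u \<in> {0..1}" for u :: real
  proof -
    have "(LINT v:{0..1}|lborel. 2 * min u v) = (LINT v:{0..1}|lborel. v + (u - \<bar>u - v\<bar>))"
      by (intro set_lebesgue_integral_cong) auto
    also have "\<dots> = (LINT v:{0..1}|lborel. v) + (LINT v:{u - u..u + (1 - u)}|lborel. u - \<bar>u - v\<bar>)"
      by (subst set_integral_add) (auto intro!: borel_integrable_atLeastAtMost' continuous_intros)
    also have "(LINT v:{0..1}|lborel. v) = (1::real) / 2"
      by (rule set_integral_unit_id)
    also have "(LINT v:{u - u..u + (1 - u)}|lborel. u - \<bar>u - v\<bar>) = u - (u\<^sup>2 + (1 - u)\<^sup>2) / 2"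
      using that by (subst set_integral_const_minus_abs_diff) auto
    finally show ?thesis by (simp add: power2_eq_square field_simps)
  qed
  have "set_integrable lborel ({0..1} \<times> {0..1}) (\<lambda>p. 2 * min (fst p) (snd p) :: real)"
    by (intro set_integrable_unit_square_bounded[where B = 2]) (auto simp: abs_le_iff borel_prod[symmetric])
  from set_integral_prod_iterated(2)[OF this]
  have "(LINT p:{0..1} \<times> {0..1}|lborel. 2 * min (fst p) (snd p) :: real) =
      (LINT u:{0..1}|lborel. LINT v:{0..1}|lborel. 2 * min u v)"
    by simp
  also have "\<dots> = (LINT u:{0..1}|lborel. 2 * u - u\<^sup>2)"
    by (rule set_lebesgue_integral_cong) (simp, intro allI impI inner)
  also have "\<dots> = (1\<^sup>2 - 1 ^ 3 / 3) - (0\<^sup>2 - 0 ^ 3 / 3)"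
    by (rule set_integral_real_FTC[where F = "\<lambda>x. x\<^sup>2 - x ^ 3 / 3"])
       (auto intro!: derivative_eq_intros continuous_intros)
  finally show ?thesis by simp
qed

section \<open>The diagonal strip\<close>

text \<open>
  The largest amount by which the section of the strip at distance \<open>u\<close> from one end of the
  diagonal can push the one-sided contribution below \<open>2 c g\<close>.  The section has length
  \<open>min u c\<close> on that side instead of \<open>c\<close>; since \<open>g \<le> u\<close>, the missing piece costs at most
  \<open>2 u (c - min u c)\<close>, and the subtracted integral of \<open>\<bar>u - v\<bar>\<close> is \<open>(min u c)\<^sup>2 / 2\<close>.
\<close>
definition strip_loss :: "real \<Rightarrow> real \<Rightarrow> real" where
  "strip_loss c u = 2 * u * (c - min u c) + (min u c)\<^sup>2 / 2"

lemma continuous_strip_loss: "continuous_on S (strip_loss c)"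
  unfolding strip_loss_def by (intro continuous_intros) auto

text \<open>
  The average of the loss is the value \<open>c\<^sup>2 / 2\<close> that it has away from the end: on \<open>{0..c}\<close> it is
  \<open>2 c u - 3 u\<^sup>2 / 2\<close>, whose integral \<open>c\<^sup>3 / 2\<close> is also that of the constant \<open>c\<^sup>2 / 2\<close>.
\<close>
lemma integral_strip_loss:
  assumes "0 \<le> c" "c \<le> 1"
  shows "(strip_loss c has_integral c\<^sup>2 / 2) {0..1}"
proof -
  have "(strip_loss c has_integral ((c * c\<^sup>2 - c ^ 3 / 2) - (c * 0\<^sup>2 - 0 ^ 3 / 2))) {0..c}"
    using assms continuous_strip_loss
    by (intro fundamental_theorem_of_calculus_interior[where f = "\<lambda>x. c * x\<^sup>2 - x ^ 3 / 2"])
       (auto intro!: continuous_intros derivative_eq_intros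
          simp: has_real_derivative_iff_has_vector_derivative[symmetric] strip_loss_def
            power2_eq_square field_simps)
  moreover have "(strip_loss c has_integral (c\<^sup>2 / 2 * 1 - c\<^sup>2 / 2 * c)) {c..1}"
    using assms
    by (intro fundamental_theorem_of_calculus_interior[where f = "\<lambda>x. c\<^sup>2 / 2 * x"])
       (auto intro!: continuous_intros derivative_eq_intros
          simp: has_real_derivative_iff_has_vector_derivative[symmetric] strip_loss_def)
  ultimately have "(strip_loss c has_integral ((c * c\<^sup>2 - c ^ 3 / 2) - (c * 0\<^sup>2 - 0 ^ 3 / 2)
      + (c\<^sup>2 / 2 * 1 - c\<^sup>2 / 2 * c))) {0..1}"
    using assms by (intro has_integral_combine)
  moreover have "(c * c\<^sup>2 - c ^ 3 / 2) - (c * 0\<^sup>2 - 0 ^ 3 / 2) + (c\<^sup>2 / 2 * 1 - c\<^sup>2 / 2 * c) = c\<^sup>2 / 2"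
    by (simp add: power2_eq_square power3_eq_cube)
  ultimately show ?thesis by simp
qed

lemma integral_strip_loss_both_ends:
  assumes "0 \<le> c" "c \<le> 1"
  shows "(LINT u:{0..1}|lborel. strip_loss c u + strip_loss c (1 - u)) = c\<^sup>2"
proof -
  have "((\<lambda>u. strip_loss c (1 - u)) has_integral c\<^sup>2 / 2) {0..1}"
    using has_integral_affinity[OF integral_strip_loss[OF assms, folded cbox_interval], of "-1" 1]
    by (simp add: image_affinity_cbox algebra_simps)
  from has_integral_add[OF integral_strip_loss[OF assms] this]
  have "((\<lambda>u. strip_loss c u + strip_loss c (1 - u)) has_integral c\<^sup>2) {0..1}" by simp
  moreover have "set_integrable lborel {0..1} (\<lambda>u. strip_loss c u + strip_loss c (1 - u))"
    unfolding strip_loss_def by (intro borel_integrable_atLeastAtMost' continuous_intros) auto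
  ultimately show ?thesis
    by (simp add: set_borel_integral_eq_integral integral_unique)
qed

text \<open>
  The right-hand side is the integral of \<open>2 g - \<bar>u - v\<bar>\<close> over \<open>v\<close> in the section
  \<open>{u - a..u + b}\<close> of the strip.  Replacing \<open>a\<close> and \<open>b\<close> by \<open>c\<close> in its first term overestimates it
  by \<open>2 g (c - a) + 2 g (c - b)\<close>, where \<open>g\<close> is at most the distance to either end.
\<close>
lemma strip_section_lower_bound:
  fixes u c g :: real
  assumes "0 \<le> c" "u \<in> {0..1}" "0 \<le> g" "g \<le> u" "g \<le> 1 - u"
  defines "a \<equiv> min u c" and "b \<equiv> min (1 - u) c"
  shows "4 * c * g - (strip_loss c u + strip_loss c (1 - u)) \<le> 2 * g * (a + b) - (a\<^sup>2 + b\<^sup>2) / 2"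
proof -
  have "g * (c - a) \<le> u * (c - a)" "g * (c - b) \<le> (1 - u) * (c - b)"
    using assms by (auto intro!: mult_right_mono)
  then show ?thesis
    unfolding strip_loss_def a_def[symmetric] b_def[symmetric] by (simp add: algebra_simps add_divide_distrib)
qed

text \<open>
  For \<open>g u = u - C u u\<close>, the value on the strip is \<open>2 min u v - (C u u + C v v)\<close>.
\<close>
definition strip_deficit :: "(real \<Rightarrow> real) \<Rightarrow> real \<Rightarrow> real \<times> real \<Rightarrow> real" where
  "strip_deficit g c p = (if \<bar>fst p - snd p\<bar> \<le> c then g (fst p) + g (snd p) - \<bar>fst p - snd p\<bar> else 0)"

lemma integral_strip_deficit:
  fixes g :: "real \<Rightarrow> real"
  assumes g[measurable]: "g \<in> borel_measurable borel"
    and c: "0 \<le> c" "c \<le> 1"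
    and bounds: "\<And>u. u \<in> {0..1} \<Longrightarrow> 0 \<le> g u \<and> g u \<le> u \<and> g u \<le> 1 - u"
  shows "set_integrable lborel ({0..1} \<times> {0..1}) (strip_deficit g c)"
    and "4 * c * (LINT u:{0..1}|lborel. g u) - c\<^sup>2 \<le>
      (LINT p:{0..1} \<times> {0..1}|lborel. strip_deficit g c p)"
proof -
  let ?Q = "{0..1} \<times> {0..1} :: (real \<times> real) set"
  \<comment> \<open>By symmetry of the strip, the terms in \<open>g u\<close> and in \<open>g v\<close> have the same integral; with
    only \<open>g u\<close> left, the inner integral over \<open>v\<close> is elementary.\<close>
  define f where "f = (\<lambda>p. if \<bar>fst p - snd p\<bar> \<le> c then g (fst p) - \<bar>fst p - snd p\<bar> / 2 else 0)"
  have [measurable]: "f \<in> borel_measurable (borel \<Otimes>\<^sub>M borel)"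
    unfolding f_def by measurable
  have bound: "\<bar>f p\<bar> \<le> 2" if "p \<in> ?Q" for p
  proof -
    have "0 \<le> g (fst p)" "g (fst p) \<le> 1"
      using that bounds[of "fst p"] by auto
    moreover have "\<bar>fst p - snd p\<bar> \<le> 1"
      using that by auto
    ultimately have "\<bar>g (fst p) - t / 2\<bar> \<le> 2" if "t = \<bar>fst p - snd p\<bar>" for t
      using that abs_ge_zero[of "fst p - snd p"] by (intro abs_leI) linarith+
    then show ?thesis
      unfolding f_def by simp
  qed
  have f: "set_integrable lborel ?Q f"
    by (rule set_integrable_unit_square_bounded[where B = 2])
       (use bound in \<open>auto simp: borel_prod[symmetric]\<close>)
  have split: "strip_deficit g c = (\<lambda>p. f p + f (snd p, fst p))"
    by (auto simp: strip_deficit_def f_def fun_eq_iff abs_minus_commute)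
  show "set_integrable lborel ?Q (strip_deficit g c)"
    unfolding split by (intro set_integral_add f set_integral_square_swap(1))
  have f2: "set_integrable lborel ?Q (\<lambda>p. 2 * f p)"
    using f by simp
  have total: "(LINT p:?Q|lborel. strip_deficit g c p) =
      (LINT u:{0..1}|lborel. LINT v:{0..1}|lborel. 2 * f (u, v))"
    unfolding split set_integral_prod_iterated(2)[OF f2, symmetric]
    by (simp add: set_integral_add f set_integral_square_swap)
  have inner: "4 * c * g u - (strip_loss c u + strip_loss c (1 - u)) \<le> (LINT v:{0..1}|lborel. 2 * f (u, v))"
    if u: "u \<in> {0..1}" for u
  proof -
    let ?a = "min u c" and ?b = "min (1 - u) c"
    have "(LINT v:{0..1}|lborel. 2 * f (u, v)) = (LINT v:{u - ?a..u + ?b}|lborel. 2 * g u - \<bar>u - v\<bar>)"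
      unfolding set_lebesgue_integral_def f_def
      by (intro Bochner_Integration.integral_cong) (auto simp: indicator_def)
    also have "\<dots> = 2 * g u * (?a + ?b) - (?a\<^sup>2 + ?b\<^sup>2) / 2"
      using u c by (intro set_integral_const_minus_abs_diff) auto
    finally show ?thesis
      using strip_section_lower_bound[of c u "g u"] u c bounds[OF u] by simp
  qed
  have gi: "set_integrable lborel {0..1} g"
    unfolding set_integrable_def using bounds
    by (intro integrableI_bounded_set_indicator[where B = 1]) force+
  have li: "set_integrable lborel {0..1} (\<lambda>u. strip_loss c u + strip_loss c (1 - u))"
    unfolding strip_loss_def by (intro borel_integrable_atLeastAtMost' continuous_intros) auto
  have "4 * c * (LINT u:{0..1}|lborel. g u) - c\<^sup>2 =
      (LINT u:{0..1}|lborel. 4 * c * g u - (strip_loss c u + strip_loss c (1 - u)))"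
    using gi li c by (simp add: set_integral_diff(2) integral_strip_loss_both_ends)
  also have "\<dots> \<le> (LINT u:{0..1}|lborel. LINT v:{0..1}|lborel. 2 * f (u, v))"
    using inner gi li set_integral_prod_iterated(1)[OF f2]
    by (intro set_integral_mono set_integral_diff(1)) auto
  finally show "4 * c * (LINT u:{0..1}|lborel. g u) - c\<^sup>2 \<le> (LINT p:?Q|lborel. strip_deficit g c p)"
    unfolding total .
qed

section \<open>Copulas\<close>

lemma copulaD:
  assumes "copula C"
  shows "\<lbrakk>u \<in> {0..1}; v \<in> {0..1}\<rbrakk> \<Longrightarrow> C u v \<in> {0..1}"
    and "v \<in> {0..1} \<Longrightarrow> C 0 v = 0" and "u \<in> {0..1} \<Longrightarrow> C u 0 = 0"
    and "u \<in> {0..1} \<Longrightarrow> C u 1 = u" and "v \<in> {0..1} \<Longrightarrow> C 1 v = v"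
    and "\<lbrakk>0 \<le> u1; u1 \<le> u2; u2 \<le> 1; 0 \<le> v1; v1 \<le> v2; v2 \<le> 1\<rbrakk> \<Longrightarrow>
      C u2 v1 + C u1 v2 \<le> C u2 v2 + C u1 v1"
proof -
  note A = assms[unfolded copula_def]
  show "\<lbrakk>u \<in> {0..1}; v \<in> {0..1}\<rbrakk> \<Longrightarrow> C u v \<in> {0..1}" using A by simp
  show "v \<in> {0..1} \<Longrightarrow> C 0 v = 0" using A by simp
  show "u \<in> {0..1} \<Longrightarrow> C u 0 = 0" using A by simp
  show "u \<in> {0..1} \<Longrightarrow> C u 1 = u" using A by simp
  show "v \<in> {0..1} \<Longrightarrow> C 1 v = v" using A by simp
  show "\<lbrakk>0 \<le> u1; u1 \<le> u2; u2 \<le> 1; 0 \<le> v1; v1 \<le> v2; v2 \<le> 1\<rbrakk> \<Longrightarrow>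
      C u2 v1 + C u1 v2 \<le> C u2 v2 + C u1 v1"
    using A[THEN conjunct2, THEN conjunct2, THEN conjunct2, THEN conjunct2, THEN conjunct2,
      rule_format, of u1 u2 v1 v2] by simp
qed

lemma copula_transpose:
  assumes "copula C"
  shows "copula (\<lambda>u v. C v u)"
  unfolding copula_def
proof (intro conjI ballI allI impI)
  fix u1 u2 v1 v2 :: real
  assume "0 \<le> u1 \<and> u1 \<le> u2 \<and> u2 \<le> 1 \<and> 0 \<le> v1 \<and> v1 \<le> v2 \<and> v2 \<le> 1"
  then show "0 \<le> C v2 u2 - C v1 u2 - C v2 u1 + C v1 u1"
    using copulaD(6)[OF assms, of v1 v2 u1 u2] by simp
qed (use copulaD(1-5)[OF assms] in simp_all)

lemma copula_increment:
  assumes "copula C" "0 \<le> u" "u \<le> u'" "u' \<le> 1" "v \<in> {0..1}"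
  shows "0 \<le> C u' v - C u v" "C u' v - C u v \<le> u' - u"
  using copulaD(6)[OF assms(1), of u u' 0 v] copulaD(6)[OF assms(1), of u u' v 1]
    copulaD(3,4)[OF assms(1), of u] copulaD(3,4)[OF assms(1), of u'] assms(2-)
  by auto

lemma copula_lipschitz:
  assumes "copula C" "u \<in> {0..1}" "u' \<in> {0..1}" "v \<in> {0..1}" "v' \<in> {0..1}"
  shows "\<bar>C u' v' - C u v\<bar> \<le> \<bar>u' - u\<bar> + \<bar>v' - v\<bar>"
proof -
  have step: "\<bar>D y z - D x z\<bar> \<le> \<bar>y - x\<bar>"
    if "copula D" "x \<in> {0..1}" "y \<in> {0..1}" "z \<in> {0..1}" for D x y z
    using copula_increment[OF that(1), of x y z] copula_increment[OF that(1), of y x z] that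
    by (cases "x \<le> y") auto
  show ?thesis
    using step[of C u u' v'] step[OF copula_transpose[OF assms(1)], of v v' u] assms by auto
qed

lemma continuous_on_copula:
  assumes "copula C"
  shows "continuous_on ({0..1} \<times> {0..1}) (\<lambda>p. C (fst p) (snd p))"
proof -
  have "2-lipschitz_on ({0..1} \<times> {0..1}) (\<lambda>p. C (fst p) (snd p))"
  proof (rule lipschitz_onI)
    fix p q :: "real \<times> real"
    assume "p \<in> {0..1} \<times> {0..1}" "q \<in> {0..1} \<times> {0..1}"
    then have "dist (C (fst p) (snd p)) (C (fst q) (snd q)) \<le> dist (fst p) (fst q) + dist (snd p) (snd q)"
      using copula_lipschitz[OF assms] by (auto simp: dist_real_def)
    then show "dist (C (fst p) (snd p)) (C (fst q) (snd q)) \<le> 2 * dist p q"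
      using dist_fst_le[of p q] dist_snd_le[of p q] by linarith
  qed simp
  then show ?thesis by (rule lipschitz_on_continuous_on)
qed

lemma copula_le_min:
  assumes "copula C" "u \<in> {0..1}" "v \<in> {0..1}"
  shows "C u v \<le> min u v"
  using copula_increment(1)[OF assms(1), of u 1 v] copulaD(5)[OF assms(1), of v]
    copula_increment(1)[OF copula_transpose[OF assms(1)], of v 1 u] copulaD(4)[OF assms(1), of u] assms(2-)
  by auto

lemma copula_ge_sum_minus_1:
  assumes "copula C" "u \<in> {0..1}" "v \<in> {0..1}"
  shows "u + v - 1 \<le> C u v"
  using copulaD(6)[OF assms(1), of u 1 v 1] copulaD(4)[OF assms(1), of u] copulaD(5)[OF assms(1), of v]
     copulaD(5)[OF assms(1), of 1] assms(2-)
  by auto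

text \<open>
  For \<open>u \<le> v\<close> the square \<open>[u, v] \<times> [u, v]\<close> has nonnegative mass, and its off-diagonal corners
  enter symmetrically.
\<close>
lemma copula_symmetrized_le_diagonal:
  assumes "copula C" "u \<in> {0..1}" "v \<in> {0..1}"
  shows "C u v + C v u \<le> C u u + C v v"
  using copulaD(6)[OF assms(1), of u v u v] copulaD(6)[OF assms(1), of v u v u] assms(2-)
  by (cases "u \<le> v") auto

lemma copula_symmetrized_le:
  assumes "copula C" "u \<in> {0..1}" "v \<in> {0..1}"
    and "g u = u - C u u" "g v = v - C v v"
  shows "C u v + C v u \<le> 2 * min u v - strip_deficit g c (u, v)"
  using copula_symmetrized_le_diagonal[OF assms(1-3)] copula_le_min[OF assms(1-3)]
    copula_le_min[OF assms(1,3,2)] assms(4,5)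
  by (auto simp: strip_deficit_def min_def split: if_splits)

theorem theorem10:
  fixes C :: "real \<Rightarrow> real \<Rightarrow> real"
  assumes "copula C"
  shows "spearman_rho C \<le> 1 - 2 / 3 * (1 - spearman_footrule C)\<^sup>2"
proof -
  let ?Q = "{0..1} \<times> {0..1} :: (real \<times> real) set"
  \<comment> \<open>Outside the unit interval \<open>C\<close> is arbitrary, so the function is cut off there to make it
    measurable on the whole line.\<close>
  define g where "g = (\<lambda>u. indicator {0..1} u *\<^sub>R (u - C u u))"
  define d where "d = (LINT u:{0..1}|lborel. C u u)"
  \<comment> \<open>This is twice the integral of \<open>g\<close>, the half-width for which the strip bound is best.\<close>
  define c where "c = 1 - 2 * d"
  have diag: "continuous_on {0..1} (\<lambda>u. C u u)"
  proof -
    have "continuous_on {0..1} (\<lambda>u::real. (u, u))"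
      by (intro continuous_intros)
    from continuous_on_compose2[OF continuous_on_copula[OF assms] this] show ?thesis
      by auto
  qed
  have g_eq: "g u = u - C u u" if "u \<in> {0..1}" for u
    using that by (simp add: g_def)
  have g_meas: "g \<in> borel_measurable borel"
    unfolding g_def using diag
    by (intro borel_measurable_continuous_on_indicator continuous_intros) auto
  have g_bounds: "0 \<le> g u \<and> g u \<le> u \<and> g u \<le> 1 - u" if "u \<in> {0..1}" for u
    using copula_le_min[OF assms that that] copula_ge_sum_minus_1[OF assms that that]
      copulaD(1)[OF assms that that] that
    by (simp add: g_eq)
  have diag_int: "set_integrable lborel {0..1} (\<lambda>u. C u u)"
    by (rule borel_integrable_atLeastAtMost'[OF diag])
  have id_int: "set_integrable lborel {0..1} (\<lambda>u::real. u)"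
    by (intro borel_integrable_atLeastAtMost' continuous_intros)
  have "(LINT u:{0..1}|lborel. g u) = (LINT u:{0..1}|lborel. u - C u u)"
    by (intro set_lebesgue_integral_cong) (auto simp: g_eq)
  also have "\<dots> = c / 2"
    using diag_int id_int set_integral_unit_id by (simp add: set_integral_diff(2) c_def d_def)
  finally have g_int: "(LINT u:{0..1}|lborel. g u) = c / 2" .
  have "0 \<le> d"
    unfolding d_def set_lebesgue_integral_def using copulaD(1)[OF assms]
    by (intro integral_nonneg_AE) (auto simp: indicator_def)
  moreover have "d \<le> 1 / 2"
    unfolding d_def set_integral_unit_id[symmetric] using copula_le_min[OF assms]
    by (intro set_integral_mono diag_int id_int) fastforce
  ultimately have c: "0 \<le> c" "c \<le> 1"
    by (auto simp: c_def)
  note strip = integral_strip_deficit[OF g_meas c g_bounds]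
  have C_int: "set_integrable lborel ?Q (\<lambda>p. C (fst p) (snd p))"
    unfolding set_integrable_def
    by (intro borel_integrable_compact compact_Times compact_Icc continuous_on_copula assms)
  have min_int: "set_integrable lborel ?Q (\<lambda>p. 2 * min (fst p) (snd p))"
    unfolding set_integrable_def
    by (intro borel_integrable_compact compact_Times compact_Icc continuous_intros)
  note swap = set_integral_square_swap[OF C_int, simplified]
  have "2 * (LINT p:?Q|lborel. C (fst p) (snd p)) =
      (LINT p:?Q|lborel. C (fst p) (snd p) + C (snd p) (fst p))"
    using C_int swap by (simp add: set_integral_add(2))
  also have "\<dots> \<le> (LINT p:?Q|lborel. 2 * min (fst p) (snd p) - strip_deficit g c p)"
    using copula_symmetrized_le[OF assms, of _ _ g c] g_eq
    by (intro set_integral_mono set_integral_add(1) set_integral_diff(1) C_int swap min_int strip(1))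
       auto
  also have "\<dots> = 2 / 3 - (LINT p:?Q|lborel. strip_deficit g c p)"
    by (simp only: set_integral_diff(2)[OF min_int strip(1)] set_integral_double_min)
  also have "\<dots> \<le> 2 / 3 - c\<^sup>2"
    using strip(2) by (simp add: g_int power2_eq_square)
  finally have "12 * (LINT p:?Q|lborel. C (fst p) (snd p)) - 3 \<le> 1 - 6 * c\<^sup>2"
    by simp
  moreover have "1 - spearman_footrule C = 3 * c"
    by (simp add: spearman_footrule_def c_def d_def)
  ultimately show ?thesis
    by (simp add: spearman_rho_def power_mult_distrib)
qed

end
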